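(* Let $A$ be a finitely generated abelian group with basis $\langle a_1,\dots,a_n\rangle$, and let $G=Dih(A)$ with adjoined involution $b$. Let $w$ be an integer with $1\le w\le n$ and let $\pi$ be a permutation of $\{1,2,\dots,n\}$. Then the ordered sequence $$\langle a_{\pi(1)}, \ldots, a_{\pi(w)}, b, a_{\pi(w+1)}, \ldots, a_{\pi(n)}\rangle$$ forms an OGS for $G$, in which the ranges of the exponents are $0\le i<|a_k|$ for $a_k$ of finite order $|a_k|$, $i\in\mathbb{Z}$ for $a_k$ of infinite order, and $0\le j<2$ for $b$. The exchange laws of this OGS canonical form are: (1) $a_{\pi(k)}\cdot a_{\pi(j)}=a_{\pi(j)}\cdot a_{\pi(k)}$ for $1\leq j,k\leq n$; (2) $b\cdot a_{\pi(k)}^{i}=a_{\pi(k)}^{-i}\cdot b$ for $1\leq k\leq w$ and every integer $i$; (3) $a_{\pi(k)}^{i}\cdot b = b\cdot a_{\pi(k)}^{-i}$ for $w+1\leq k\leq n$ and every integer $i$.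
   Context: A basis $\langle a_1,\dots,a_n\rangle$ of a finitely generated abelian group $A$ (written multiplicatively) is a sequence of generators such that every $a\in A$ has a unique presentation $a=a_1^{i_1}\cdots a_n^{i_n}$ with $0\le i_k<|a_k|$ if $a_k$ has finite order $|a_k|$ and $i_k\in\mathbb{Z}$ if $a_k$ has infinite order. $Dih(A)$ is the dihedral group of order $2|A|$: the extension (semidirect product) of $A$ by an involution $b\notin A$ acting by $b^{-1}ab=a^{-1}$ for every $a\in A$. OGS: an ordered sequence $\langle g_1,\dots,g_N\rangle$ of elements of a group $G$ is an Ordered Generating System (OGS) of $G$ if every $g\in G$ has a unique presentation $g=g_1^{i_1}g_2^{i_2}\cdots g_N^{i_N}$ with $0\le i_k<r_k$, where $r_k$ divides $|g_k|$, if $g_k$ has finite order, and $i_k\in\mathbb{Z}$ if $g_k$ has infinite order. Exchange laws are relations that rewrite products $g_q^{x_q}g_p^{x_p}$ with $q>p$ into the canonical form. *)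

theory Defs
  imports "HOL-Algebra.Algebra" "HOL-Combinatorics.Permutations"
begin

text \<open>Throughout, an exponent bound \<open>r = 0\<close> stands for "no bound". This matches
  \<^const>\<open>group.ord\<close>, which is \<open>0\<close> for elements of infinite order, so the range of exponents
  attached to \<open>g\<close> by its order is \<open>exp_range (group.ord G g)\<close>.\<close>

definition exp_range :: "nat \<Rightarrow> int set" where
  "exp_range r = (if r = 0 then UNIV else {0..<int r})"

definition power_word :: "('g, 'm) monoid_scheme \<Rightarrow> 'g list \<Rightarrow> int list \<Rightarrow> 'g" where
  "power_word G gs es = foldr (\<lambda>x y. x \<otimes>\<^bsub>G\<^esub> y) (map2 (\<lambda>g e. g [^]\<^bsub>G\<^esub> e) gs es) \<one>\<^bsub>G\<^esub>"

definition unique_presentation :: "('g, 'm) monoid_scheme \<Rightarrow> 'g list \<Rightarrow> nat list \<Rightarrow> 'g \<Rightarrow> bool" where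
  "unique_presentation G gs rs g \<longleftrightarrow>
     (\<exists>!es. list_all2 (\<lambda>e r. e \<in> exp_range r) es rs \<and> power_word G gs es = g)"

definition finitely_generated :: "('g, 'm) monoid_scheme \<Rightarrow> bool" where
  "finitely_generated G \<longleftrightarrow> (\<exists>S. finite S \<and> S \<subseteq> carrier G \<and> generate G S = carrier G)"

definition is_basis :: "('g, 'm) monoid_scheme \<Rightarrow> 'g list \<Rightarrow> bool" where
  "is_basis A as \<longleftrightarrow>
     comm_group A \<and> set as \<subseteq> carrier A \<and> generate A (set as) = carrier A \<and>
     (\<forall>x\<in>carrier A. unique_presentation A as (map (group.ord A) as) x)"

text \<open>\<open>is_OGS G gs rs\<close>: the sequence \<open>gs\<close> is an ordered generating system of \<open>G\<close> with exponent
  bounds \<open>rs\<close>. For an element of finite order the divisibility condition also excludes the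
  bound \<open>0\<close>.\<close>

definition is_OGS :: "('g, 'm) monoid_scheme \<Rightarrow> 'g list \<Rightarrow> nat list \<Rightarrow> bool" where
  "is_OGS G gs rs \<longleftrightarrow>
     group G \<and> set gs \<subseteq> carrier G \<and>
     list_all2 (\<lambda>g r. if group.ord G g = 0 then r = 0 else r dvd group.ord G g) gs rs \<and>
     (\<forall>x\<in>carrier G. unique_presentation G gs rs x)"

text \<open>An exchange law at (0-based) positions \<open>p < q\<close>: the out-of-order product
  \<open>g\<^sub>q\<^sup>x g\<^sub>p\<^sup>y\<close> has the canonical form \<open>g\<^sub>p\<^sup>u g\<^sub>q\<^sup>v\<close>,
  with \<open>u\<close> and \<open>v\<close> in the ranges prescribed by the OGS.\<close>

definition exchange_law ::
  "('g, 'm) monoid_scheme \<Rightarrow> 'g list \<Rightarrow> nat list \<Rightarrow> nat \<Rightarrow> nat \<Rightarrow> int \<Rightarrow> int \<Rightarrow> int \<Rightarrow> int \<Rightarrow> bool" where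
  "exchange_law G gs rs q p x y u v \<longleftrightarrow>
     p < q \<and> q < length gs \<and> u \<in> exp_range (rs ! p) \<and> v \<in> exp_range (rs ! q) \<and>
     (gs ! q) [^]\<^bsub>G\<^esub> x \<otimes>\<^bsub>G\<^esub> (gs ! p) [^]\<^bsub>G\<^esub> y =
     (gs ! p) [^]\<^bsub>G\<^esub> u \<otimes>\<^bsub>G\<^esub> (gs ! q) [^]\<^bsub>G\<^esub> v"

text \<open>\<open>is_Dih G A b\<close>: the group \<open>G\<close> is (internally) the dihedral group \<open>Dih(A)\<close> of its abelian
  subgroup \<open>A\<close>, with adjoined involution \<open>b\<close>. The last condition says that \<open>A\<close> has exactly the
  two cosets \<open>A\<close> and \<open>Ab\<close>, i.e. \<open>|G| = 2|A|\<close> when \<open>A\<close> is finite. The group \<open>A\<close> itself is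
  \<open>G\<lparr>carrier := A\<rparr>\<close>.\<close>

definition is_Dih :: "('g, 'm) monoid_scheme \<Rightarrow> 'g set \<Rightarrow> 'g \<Rightarrow> bool" where
  "is_Dih G A b \<longleftrightarrow>
     group G \<and> subgroup A G \<and> comm_group (G\<lparr>carrier := A\<rparr>) \<and>
     b \<in> carrier G \<and> b \<notin> A \<and> b \<otimes>\<^bsub>G\<^esub> b = \<one>\<^bsub>G\<^esub> \<and>
     (\<forall>a\<in>A. inv\<^bsub>G\<^esub> b \<otimes>\<^bsub>G\<^esub> a \<otimes>\<^bsub>G\<^esub> b = inv\<^bsub>G\<^esub> a) \<and>
     carrier G = A \<union> (A #>\<^bsub>G\<^esub> b)"

text \<open>The external semidirect product, in which \<open>(x, s)\<close> stands for \<open>x b\<^sup>s\<close>. It shows that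
  every abelian group \<open>A\<close> has a dihedral extension in the sense of \<open>is_Dih\<close>.\<close>

definition Dih_model :: "('a, 'm) monoid_scheme \<Rightarrow> ('a \<times> bool) monoid" where
  "Dih_model A = \<lparr>carrier = carrier A \<times> UNIV,
     monoid.mult = (\<lambda>(x, s) (y, t). (x \<otimes>\<^bsub>A\<^esub> (if s then inv\<^bsub>A\<^esub> y else y), s \<noteq> t)),
     one = (\<one>\<^bsub>A\<^esub>, False)\<rparr>"

lemma is_Dih_Dih_model:
  assumes "comm_group A"
  shows "is_Dih (Dih_model A) (carrier A \<times> {False}) (\<one>\<^bsub>A\<^esub>, True)"
    and "(\<lambda>a. (a, False)) \<in> iso A ((Dih_model A)\<lparr>carrier := carrier A \<times> {False}\<rparr>)"
proof -
  interpret A: comm_group A by fact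
  let ?D = "Dih_model A" and ?H = "carrier A \<times> {False}"
  have grp: "group ?D"
  proof (rule groupI)
    fix x assume "x \<in> carrier ?D"
    then obtain a s where "x = (a, s)" "a \<in> carrier A" by (auto simp: Dih_model_def)
    then show "\<exists>y\<in>carrier ?D. y \<otimes>\<^bsub>?D\<^esub> x = \<one>\<^bsub>?D\<^esub>"
      by (intro bexI[of _ "(if s then a else inv\<^bsub>A\<^esub> a, s)"]) (auto simp: Dih_model_def)
  qed (auto simp: Dih_model_def A.m_assoc A.inv_mult)
  interpret D: group ?D by (fact grp)
  have inv_False: "inv\<^bsub>?D\<^esub> (a, False) = (inv\<^bsub>A\<^esub> a, False)" if "a \<in> carrier A" for a
    using that by (intro D.inv_equality) (auto simp: Dih_model_def)
  have inv_b: "inv\<^bsub>?D\<^esub> (\<one>\<^bsub>A\<^esub>, True) = (\<one>\<^bsub>A\<^esub>, True)"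
    by (intro D.inv_equality) (auto simp: Dih_model_def)
  have sub: "subgroup ?H ?D"
    by (rule D.subgroupI) (auto simp: inv_False, auto simp: Dih_model_def)
  have comm: "comm_group (?D\<lparr>carrier := ?H\<rparr>)"
  proof (rule group.group_comm_groupI[OF D.subgroup_imp_group[OF sub]])
    fix x y assume "x \<in> carrier (?D\<lparr>carrier := ?H\<rparr>)" "y \<in> carrier (?D\<lparr>carrier := ?H\<rparr>)"
    then show "x \<otimes>\<^bsub>?D\<lparr>carrier := ?H\<rparr>\<^esub> y = y \<otimes>\<^bsub>?D\<lparr>carrier := ?H\<rparr>\<^esub> x"
      using A.m_comm by (auto simp: Dih_model_def)
  qed
  have coset: "?H #>\<^bsub>?D\<^esub> (\<one>\<^bsub>A\<^esub>, True) = carrier A \<times> {True}"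
    by (force simp: r_coset_def Dih_model_def)
  have cosets: "carrier ?D = ?H \<union> (?H #>\<^bsub>?D\<^esub> (\<one>\<^bsub>A\<^esub>, True))"
    unfolding coset by (auto simp: Dih_model_def)
  have conj: "\<forall>a\<in>?H. inv\<^bsub>?D\<^esub> (\<one>\<^bsub>A\<^esub>, True) \<otimes>\<^bsub>?D\<^esub> a \<otimes>\<^bsub>?D\<^esub> (\<one>\<^bsub>A\<^esub>, True) = inv\<^bsub>?D\<^esub> a"
  proof
    fix a assume "a \<in> ?H"
    then obtain c where c: "a = (c, False)" "c \<in> carrier A" by blast
    show "inv\<^bsub>?D\<^esub> (\<one>\<^bsub>A\<^esub>, True) \<otimes>\<^bsub>?D\<^esub> a \<otimes>\<^bsub>?D\<^esub> (\<one>\<^bsub>A\<^esub>, True) = inv\<^bsub>?D\<^esub> a"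
      unfolding c(1) inv_b inv_False[OF c(2)] using c(2) by (simp add: Dih_model_def)
  qed
  have inD: "(\<one>\<^bsub>A\<^esub>, True) \<in> carrier ?D" "(\<one>\<^bsub>A\<^esub>, True) \<notin> ?H"
    "(\<one>\<^bsub>A\<^esub>, True) \<otimes>\<^bsub>?D\<^esub> (\<one>\<^bsub>A\<^esub>, True) = \<one>\<^bsub>?D\<^esub>"
    by (simp_all add: Dih_model_def)
  show "is_Dih ?D ?H (\<one>\<^bsub>A\<^esub>, True)"
    unfolding is_Dih_def by (intro conjI grp sub comm inD conj cosets)
  show "(\<lambda>a. (a, False)) \<in> iso A (?D\<lparr>carrier := ?H\<rparr>)"
    by (auto simp: iso_def hom_def bij_betw_def inj_on_def Dih_model_def)
qed

end

theory Submission
  imports Defs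
begin

text \<open>Write an element of \<open>G\<close> as \<open>x = P b\<^sup>j Q\<close>, where \<open>P\<close> is a word in the basis elements
  before \<open>b\<close>, \<open>Q\<close> a word in those after \<open>b\<close>, and \<open>j\<close> is \<open>0\<close> or \<open>1\<close>. Since \<open>P\<close> and \<open>Q\<close> lie in \<open>A\<close>,
  the exponent \<open>j\<close> is determined by the coset of \<open>x\<close> modulo \<open>A\<close>. Conjugation by \<open>b\<close> inverts \<open>A\<close>, so
  \<open>x b\<^sup>j\<close> is \<open>P Q\<close> for \<open>j = 0\<close> and \<open>P Q\<^sup>-\<^sup>1\<close> for \<open>j = 1\<close> (\<open>power_word_insert_b\<close>). As \<open>A\<close> is
  abelian, \<open>Q\<^sup>-\<^sup>1\<close> is the word in the same basis elements with negated exponents, reduced modulo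
  the orders (\<open>power_word_negate_exps\<close>). This change of exponents is an involution on the admissible
  exponent sequences. Hence the presentations of \<open>x\<close> in \<open>G\<close> correspond bijectively to the
  presentations, in the given basis of \<open>A\<close>, of the element \<open>x b\<^sup>j \<in> A\<close>, and of the latter there is
  exactly one (\<open>unique_presentation_insert_b\<close>).

  The basis elements may be permuted because in an abelian group a word is a product
  over the set of indices (\<open>unique_presentation_reorder\<close>). The exchange laws all come from the one
  relation \<open>b\<^sup>j x\<^sup>i = x\<^sup>\<plusminus>\<^sup>i b\<^sup>j\<close> for \<open>x \<in> A\<close>, with sign \<open>(-1)\<^sup>j\<close>.\<close>

abbreviation in_ranges :: "int list \<Rightarrow> nat list \<Rightarrow> bool" where
  "in_ranges \<equiv> list_all2 (\<lambda>e r. e \<in> exp_range r)"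

section \<open>Exponents and words\<close>

lemma mod_in_exp_range: "x mod int r \<in> exp_range r"
  by (simp add: exp_range_def)

lemma mod_id_exp_range: "x \<in> exp_range r \<Longrightarrow> x mod int r = x"
  by (auto simp: exp_range_def split: if_splits)

lemma power_word_simps [simp]:
  "power_word G [] es = \<one>\<^bsub>G\<^esub>"
  "power_word G gs [] = \<one>\<^bsub>G\<^esub>"
  "power_word G (g # gs) (e # es) = g [^]\<^bsub>G\<^esub> e \<otimes>\<^bsub>G\<^esub> power_word G gs es"
  by (simp_all add: power_word_def)

context group
begin

lemma int_pow_mod_ord: "x \<in> carrier G \<Longrightarrow> x [^] (i mod int (ord x)) = x [^] i"
  by (subst int_pow_eq) (auto simp: minus_mod_eq_mult_div)

lemma power_word_closed [simp]: "set gs \<subseteq> carrier G \<Longrightarrow> power_word G gs es \<in> carrier G"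
proof (induction gs arbitrary: es)
  case (Cons g gs) then show ?case by (cases es) auto
qed simp

lemma power_word_append:
  assumes "set (gs @ hs) \<subseteq> carrier G" "length es = length gs"
  shows "power_word G (gs @ hs) (es @ fs) = power_word G gs es \<otimes> power_word G hs fs"
  using assms(2,1) by (induction es gs rule: list_induct2) (auto simp: m_assoc)

text \<open>Powers, words and orders do not depend on whether they are formed in \<open>G\<close> or in a subgroup.
  This lets words in the abelian subgroup be manipulated with the laws of commutative groups.\<close>

lemma power_word_subgroup:
  assumes "subgroup A G" "set gs \<subseteq> A"
  shows "power_word (G\<lparr>carrier := A\<rparr>) gs es = power_word G gs es"
  using assms(2)
proof (induction gs arbitrary: es)
  case (Cons g gs)
  then show ?case
    using int_pow_consistent[OF assms(1), of g] by (cases es) auto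
qed simp

lemma ord_subgroup:
  assumes "subgroup A G"
  shows "group.ord (G\<lparr>carrier := A\<rparr>) x = ord x"
proof -
  have "group (G\<lparr>carrier := A\<rparr>)"
    using assms by (rule subgroup_imp_group)
  then show ?thesis
    by (simp add: group.ord_def ord_def nat_pow_consistent[symmetric])
qed

end

section \<open>Bases of abelian groups\<close>

text \<open>The exponents of the inverse of a word in commuting elements, brought back into the
  prescribed ranges; for \<open>r = 0\<close> the reduction does nothing, as \<open>x mod 0 = x\<close>.\<close>

definition negate_exps :: "nat list \<Rightarrow> int list \<Rightarrow> int list" where
  "negate_exps rs es = map2 (\<lambda>r e. (- e) mod int r) rs es"

lemma in_ranges_negate_exps:
  "length es = length rs \<Longrightarrow> in_ranges (negate_exps rs es) rs"
  by (auto simp: negate_exps_def list_all2_conv_all_nth mod_in_exp_range)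

lemma negate_exps_involution:
  assumes "in_ranges es rs"
  shows "negate_exps rs (negate_exps rs es) = es"
proof (rule nth_equalityI)
  show "length (negate_exps rs (negate_exps rs es)) = length es"
    using assms by (simp add: negate_exps_def list_all2_lengthD)
  show "negate_exps rs (negate_exps rs es) ! i = es ! i"
    if "i < length (negate_exps rs (negate_exps rs es))" for i
    using assms that
    by (auto simp: negate_exps_def list_all2_conv_all_nth mod_minus_eq mod_id_exp_range)
qed

context comm_group
begin

lemma power_word_negate_exps:
  assumes "set gs \<subseteq> carrier G" "length es = length gs"
  shows "power_word G gs (negate_exps (map ord gs) es) = inv (power_word G gs es)"
  using assms(2,1)
proof (induction es gs rule: list_induct2)
  case (Cons e es g gs)
  then have "g [^] ((- e) mod int (ord g)) = inv (g [^] e)"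
    by (simp add: int_pow_mod_ord int_pow_neg)
  with Cons show ?case
    by (simp add: negate_exps_def inv_mult)
qed (simp add: negate_exps_def)

lemma power_word_eq_finprod:
  assumes "distinct ks" "c ` set ks \<subseteq> carrier G"
  shows "power_word G (map c ks) (map f ks) = finprod G (\<lambda>k. c k [^] (f k :: int)) (set ks)"
  using assms
proof (induction ks)
  case (Cons k ks)
  then have "c k [^] f k \<in> carrier G" "(\<lambda>k. c k [^] f k) \<in> set ks \<rightarrow> carrier G"
    by auto
  with Cons show ?case by simp
qed simp

text \<open>The exponent sequence is replaced by a function on the set of indices, so that the order in
  which the indices are listed no longer enters the right-hand side. The functions are taken
  extensional to make their correspondence with sequences bijective.\<close>

lemma unique_presentation_iff_finprod:
  assumes "distinct ks" "c ` set ks \<subseteq> carrier G"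
  shows "unique_presentation G (map c ks) (map r ks) x \<longleftrightarrow>
    (\<exists>!f. f \<in> (\<Pi>\<^sub>E k\<in>set ks. exp_range (r k)) \<and>
       finprod G (\<lambda>k. c k [^] (f k :: int)) (set ks) = x)"
proof -
  let ?F = "\<Pi>\<^sub>E k\<in>set ks. exp_range (r k)" and ?E = "{es. in_ranges es (map r ks)}"
  have inj: "inj_on (\<lambda>f. map f ks) ?F"
    by (intro inj_onI PiE_ext) auto
  have onto: "(\<lambda>f. map f ks) ` ?F = ?E"
  proof (intro equalityI subsetI)
    fix es assume "es \<in> (\<lambda>f. map f ks) ` ?F"
    then show "es \<in> ?E" by (auto simp: list_all2_conv_all_nth)
  next
    fix es assume es: "es \<in> ?E"
    define f where "f = restrict (\<lambda>k. the (map_of (zip ks es) k)) (set ks)"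
    have len: "length es = length ks"
      using es by (simp add: list_all2_lengthD)
    have f: "f (ks ! i) = es ! i" if "i < length ks" for i
      using that len \<open>distinct ks\<close> by (simp add: f_def map_of_zip_nth)
    have "map f ks = es"
      by (rule nth_equalityI) (simp_all add: len f)
    moreover have "f \<in> ?F"
    proof (rule PiE_I)
      fix k assume "k \<in> set ks"
      then obtain i where "i < length ks" "k = ks ! i" by (auto simp: in_set_conv_nth)
      with es show "f k \<in> exp_range (r k)" using len by (auto simp: f list_all2_conv_all_nth)
    qed (simp add: f_def)
    ultimately show "es \<in> (\<lambda>f. map f ks) ` ?F" by blast
  qed
  have "unique_presentation G (map c ks) (map r ks) x \<longleftrightarrow>
    (\<exists>!es. es \<in> (\<lambda>f. map f ks) ` ?F \<and> power_word G (map c ks) es = x)"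
    unfolding onto by (simp add: unique_presentation_def)
  also have "\<dots> \<longleftrightarrow> (\<exists>!f. f \<in> ?F \<and> power_word G (map c ks) (map f ks) = x)"
    using inj unfolding inj_on_def by (smt (verit, best) imageE imageI)
  finally show ?thesis
    by (simp only: power_word_eq_finprod[OF assms])
qed

lemma unique_presentation_reorder:
  assumes "distinct ks" "distinct ks'" "set ks = set ks'" "c ` set ks \<subseteq> carrier G"
  shows "unique_presentation G (map c ks) (map r ks) x \<longleftrightarrow>
    unique_presentation G (map c ks') (map r ks') x"
  using assms by (simp add: unique_presentation_iff_finprod)

end

section \<open>Dihedral groups\<close>

locale dihedral = group G for G (structure) +
  fixes A :: "'a set" and b :: 'a
  assumes Dih: "is_Dih G A b"
begin

lemma subgroup_A: "subgroup A G" and comm_group_A: "comm_group (G\<lparr>carrier := A\<rparr>)"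
  and b_closed [simp]: "b \<in> carrier G" and b_notin: "b \<notin> A" and b_sq [simp]: "b \<otimes> b = \<one>"
  and carrier_eq: "carrier G = A \<union> (A #> b)"
  using Dih by (auto simp: is_Dih_def)

sublocale A: comm_group "G\<lparr>carrier := A\<rparr>"
  by (rule comm_group_A)

lemma A_closed [simp]: "x \<in> A \<Longrightarrow> x \<in> carrier G"
  using subgroup.mem_carrier[OF subgroup_A] .

lemma A_mult: "x \<in> A \<Longrightarrow> y \<in> A \<Longrightarrow> x \<otimes> y \<in> A"
  using subgroup.m_closed[OF subgroup_A] .

lemma A_inv: "x \<in> A \<Longrightarrow> inv x \<in> A"
  using subgroup.m_inv_closed[OF subgroup_A] .

lemma A_int_pow: "x \<in> A \<Longrightarrow> x [^] (i :: int) \<in> A"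
  using subgroup_int_pow_closed[OF subgroup_A] .

lemma A_comm: "x \<in> A \<Longrightarrow> y \<in> A \<Longrightarrow> x \<otimes> y = y \<otimes> x"
  using A.m_comm by simp

lemma A_power_word: "set gs \<subseteq> A \<Longrightarrow> power_word G gs es \<in> A"
  using A.power_word_closed[of gs es] power_word_subgroup[OF subgroup_A] by simp

lemma inv_b [simp]: "inv b = b"
  by (simp add: inv_equality)

lemma b_mult_A:
  assumes "x \<in> A" shows "b \<otimes> x = inv x \<otimes> b"
proof -
  have "b \<otimes> x \<otimes> b = inv x"
    using Dih assms by (simp add: is_Dih_def)
  then have "b \<otimes> x \<otimes> b \<otimes> b = inv x \<otimes> b" by simp
  then show ?thesis using assms by (simp add: m_assoc)
qed

lemma ord_b: "ord b = 2"
proof -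
  have "b [^] (2 :: nat) = \<one>" by (simp add: numeral_2_eq_2)
  then have "ord b dvd 2" by (simp add: pow_eq_id)
  moreover have "b \<noteq> \<one>"
    using b_notin subgroup.one_closed[OF subgroup_A] by metis
  then have "ord b \<noteq> 1" using ord_eq_1[OF b_closed] by metis
  ultimately show ?thesis
    using prime_nat_iff two_is_prime_nat by metis
qed

lemma int_pow_b: "b [^] (j :: int) = (if odd j then b else \<one>)"
  using int_pow_mod_ord[of b j] by (auto simp: ord_b mod2_eq_if split: if_splits)

text \<open>Multiplication by \<open>b\<close> swaps the two cosets of \<open>A\<close>; this is what fixes the exponent of \<open>b\<close>
  in a presentation.\<close>

lemma mult_b_mem_iff: "x \<in> carrier G \<Longrightarrow> x \<otimes> b \<in> A \<longleftrightarrow> x \<notin> A"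
proof
  assume x: "x \<in> carrier G" and xb: "x \<otimes> b \<in> A"
  show "x \<notin> A"
  proof
    assume "x \<in> A"
    then have "inv x \<otimes> (x \<otimes> b) \<in> A" using xb by (simp add: A_mult A_inv)
    moreover have "inv x \<otimes> (x \<otimes> b) = b" using \<open>x \<in> A\<close> by (simp flip: m_assoc)
    ultimately show False using b_notin by simp
  qed
next
  assume "x \<in> carrier G" "x \<notin> A"
  then obtain c where "c \<in> A" "x = c \<otimes> b"
    using carrier_eq by (auto simp: r_coset_def)
  then show "x \<otimes> b \<in> A" by (simp add: m_assoc)
qed

lemma b_int_pow_A:
  assumes "x \<in> A"
  shows "b \<otimes> x [^] (i :: int) = x [^] (- i) \<otimes> b"
  using b_mult_A[OF A_int_pow[OF assms, of i]] assms by (simp add: int_pow_neg)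

lemma int_pow_b_int_pow_A:
  assumes "x \<in> A"
  shows "b [^] (j :: int) \<otimes> x [^] (i :: int) = x [^] (if odd j then - i else i) \<otimes> b [^] j"
  using b_int_pow_A[OF assms, of i] assms by (simp add: int_pow_b)

lemma int_pow_A_int_pow_b:
  assumes "x \<in> A"
  shows "x [^] (i :: int) \<otimes> b [^] (j :: int) = b [^] j \<otimes> x [^] (if odd j then - i else i)"
  using int_pow_b_int_pow_A[OF assms, of j "if odd j then - i else i"] by simp

text \<open>The effect on the exponents of a word in \<open>A\<close> of conjugating by \<open>b\<^sup>j\<close>, for \<open>j \<in> {0, 1}\<close>.\<close>

definition twist :: "int \<Rightarrow> nat list \<Rightarrow> int list \<Rightarrow> int list" where
  "twist j rs fs = (if j = 0 then fs else negate_exps rs fs)"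

lemma in_ranges_twist: "in_ranges fs rs \<Longrightarrow> in_ranges (twist j rs fs) rs"
  by (simp add: twist_def in_ranges_negate_exps list_all2_lengthD)

lemma twist_involution: "in_ranges fs rs \<Longrightarrow> twist j rs (twist j rs fs) = fs"
  by (simp add: twist_def negate_exps_involution)

text \<open>Multiplying by \<open>b\<^sup>j\<close> on the right moves a word into \<open>A\<close>: from \<open>P b\<^sup>j Q b\<^sup>j\<close> the conjugate
  \<open>b\<^sup>j Q b\<^sup>j\<close> is \<open>Q\<close> or its inverse, which is again a word in the same letters.\<close>

lemma power_word_insert_b:
  assumes A: "set us \<subseteq> A" "set vs \<subseteq> A"
    and len: "length es = length us" "length fs = length vs" and j: "j \<in> {0, 1}"
  shows "power_word G (us @ [b] @ vs) (es @ [j] @ fs) \<otimes> b [^] j =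
    power_word (G\<lparr>carrier := A\<rparr>) (us @ vs) (es @ twist j (map ord vs) fs)"
proof -
  let ?P = "power_word G us es" and ?Q = "power_word G vs fs"
  let ?Q' = "power_word G vs (twist j (map ord vs) fs)"
  have PQ: "?P \<in> A" "?Q \<in> A" using A by (auto intro: A_power_word)
  have sub: "set (us @ [b] @ vs) \<subseteq> carrier G" "set (us @ vs) \<subseteq> carrier G"
    using A by auto
  have inv_Q: "power_word G vs (negate_exps (map ord vs) fs) = inv ?Q"
    using A.power_word_negate_exps[of vs fs] A len PQ
    by (simp add: power_word_subgroup[OF subgroup_A] ord_subgroup[OF subgroup_A] subgroup_A
        cong: map_cong)
  have "power_word G (us @ [b] @ vs) (es @ [j] @ fs) \<otimes> b [^] j = ?P \<otimes> (b [^] j \<otimes> ?Q \<otimes> b [^] j)"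
    using sub len PQ by (subst power_word_append) (auto simp: m_assoc)
  also have "b [^] j \<otimes> ?Q \<otimes> b [^] j = ?Q'"
  proof -
    have "b \<otimes> ?Q \<otimes> b = inv ?Q"
      using PQ by (simp add: b_mult_A m_assoc)
    then show ?thesis
      using j PQ by (auto simp: twist_def inv_Q)
  qed
  also have "?P \<otimes> ?Q' = power_word G (us @ vs) (es @ twist j (map ord vs) fs)"
    using sub len by (subst power_word_append) auto
  finally show ?thesis
    using A by (simp add: power_word_subgroup[OF subgroup_A])
qed

lemma mult_int_pow_b_mem_iff:
  assumes "x \<in> carrier G"
  shows "x \<otimes> b [^] (j :: int) \<in> A \<longleftrightarrow> (x \<in> A \<longleftrightarrow> even j)"
  using assms mult_b_mem_iff[of x] by (simp add: int_pow_b)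

text \<open>Both existence and uniqueness are transported from \<open>A\<close> along \<open>power_word_insert_b\<close>. This
  works because \<open>j\<close> is forced by the coset of \<open>x\<close>, and \<open>twist\<close> is its own inverse.\<close>

lemma unique_presentation_insert_b:
  assumes A: "set us \<subseteq> A" "set vs \<subseteq> A"
    and basis: "\<And>c. c \<in> A \<Longrightarrow>
      unique_presentation (G\<lparr>carrier := A\<rparr>) (us @ vs) (map ord us @ map ord vs) c"
    and x: "x \<in> carrier G"
  shows "unique_presentation G (us @ [b] @ vs) (map ord us @ [2] @ map ord vs) x"
proof -
  let ?gs = "us @ [b] @ vs" and ?tw = "\<lambda>j. twist j (map ord vs)"
  \<comment> \<open>The only possible exponent of \<open>b\<close>, and the element of \<open>A\<close> whose presentation decides
    that of \<open>x\<close>.\<close>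
  define d :: int where "d = (if x \<in> A then 0 else 1)"
  define c where "c = x \<otimes> b [^] d"
  have d: "d \<in> {0, 1}" by (simp add: d_def)
  have "c \<in> A"
    using x by (simp add: c_def mult_int_pow_b_mem_iff d_def)
  from basis[OF this] obtain hs where hs: "in_ranges hs (map ord us @ map ord vs)"
      "power_word (G\<lparr>carrier := A\<rparr>) (us @ vs) hs = c"
    and hs_unique: "\<And>hs'. in_ranges hs' (map ord us @ map ord vs) \<Longrightarrow>
      power_word (G\<lparr>carrier := A\<rparr>) (us @ vs) hs' = c \<Longrightarrow> hs' = hs"
    unfolding unique_presentation_def by metis
  from hs(1) obtain es fs where hs_eq: "hs = es @ fs"
    and es: "in_ranges es (map ord us)" and fs: "in_ranges fs (map ord vs)"
    by (auto simp: list_all2_append2)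
  have len: "length es = length us" "length (?tw d fs) = length vs"
    using es list_all2_lengthD[OF in_ranges_twist[OF fs, of d]] by (auto dest: list_all2_lengthD)
  show ?thesis
    unfolding unique_presentation_def
  proof (rule ex1I)
    have "power_word G ?gs (es @ [d] @ ?tw d fs) \<otimes> b [^] d = x \<otimes> b [^] d"
      using power_word_insert_b[OF A len d] hs(2) by (simp add: twist_involution[OF fs] hs_eq c_def)
    moreover have "power_word G ?gs (es @ [d] @ ?tw d fs) \<in> carrier G"
      using A by (intro power_word_closed) auto
    ultimately have "power_word G ?gs (es @ [d] @ ?tw d fs) = x"
      using x by (simp add: right_cancel)
    moreover have "in_ranges (es @ [d] @ ?tw d fs) (map ord us @ [2] @ map ord vs)"
      using in_ranges_twist[OF fs] d
      by (intro list_all2_appendI es) (auto simp: exp_range_def)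
    ultimately show "in_ranges (es @ [d] @ ?tw d fs) (map ord us @ [2] @ map ord vs) \<and>
        power_word G ?gs (es @ [d] @ ?tw d fs) = x" by blast
  next
    fix ks assume ks: "in_ranges ks (map ord us @ [2] @ map ord vs) \<and> power_word G ?gs ks = x"
    then obtain es' j fs' where ks_eq: "ks = es' @ [j] @ fs'"
      and es': "in_ranges es' (map ord us)" and fs': "in_ranges fs' (map ord vs)"
      and "j \<in> exp_range 2"
      by (auto simp: list_all2_append2 list_all2_Cons2)
    then have j: "j \<in> {0, 1}" by (auto simp: exp_range_def)
    have len': "length es' = length us" "length fs' = length vs"
      using es' fs' by (auto dest: list_all2_lengthD)
    have word: "x \<otimes> b [^] j = power_word (G\<lparr>carrier := A\<rparr>) (us @ vs) (es' @ ?tw j fs')"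
      using power_word_insert_b[OF A len' j] ks by (simp add: ks_eq)
    also have "\<dots> \<in> A"
      using A.power_word_closed[of "us @ vs"] A by simp
    finally have "j = d"
      using x j by (auto simp: mult_int_pow_b_mem_iff d_def)
    have "es' @ ?tw d fs' = es @ fs"
      unfolding hs_eq[symmetric]
    proof (rule hs_unique)
      show "in_ranges (es' @ ?tw d fs') (map ord us @ map ord vs)"
        by (intro list_all2_appendI es' in_ranges_twist fs')
    qed (use word \<open>j = d\<close> in \<open>simp add: c_def\<close>)
    then have "es' = es" "?tw d fs' = fs"
      using len len' by auto
    then show "ks = es @ [d] @ ?tw d fs"
      using twist_involution[OF fs', of d] by (simp add: ks_eq \<open>j = d\<close>)
  qed
qed

text \<open>If neither position holds \<open>b\<close>, the two powers commute. Otherwise moving \<open>b\<^sup>j\<close> across flips the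
  sign of the other exponent exactly when \<open>j\<close> is odd. Afterwards every exponent may be reduced
  modulo the order of its base.\<close>

lemma exchange_law_insert_b:
  assumes A: "set us \<subseteq> A" "set vs \<subseteq> A" and pq: "p < q" "q < length (us @ [b] @ vs)"
  shows "exchange_law G (us @ [b] @ vs) (map ord (us @ [b] @ vs)) q p x y
    ((if q = length us \<and> odd x then - y else y) mod int (map ord (us @ [b] @ vs) ! p))
    ((if p = length us \<and> odd y then - x else x) mod int (map ord (us @ [b] @ vs) ! q))"
proof -
  let ?gs = "us @ [b] @ vs"
  have b_iff: "?gs ! i = b" if "i = length us" for i
    using that by (simp add: nth_append)
  have in_A: "?gs ! i \<in> A" if "i < length ?gs" "i \<noteq> length us" for i
    using that A by (force simp: nth_append nth_Cons' subset_iff)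
  have closed: "?gs ! i \<in> carrier G" if "i < length ?gs" for i
    using in_A[OF that] b_iff[of i] by (cases "i = length us") auto
  have "(?gs ! q) [^] x \<otimes> (?gs ! p) [^] y =
    (?gs ! p) [^] (if q = length us \<and> odd x then - y else y) \<otimes>
    (?gs ! q) [^] (if p = length us \<and> odd y then - x else x)"
  proof (cases "p = length us")
    case True
    with pq show ?thesis
      using int_pow_A_int_pow_b[OF in_A, of q x y] b_iff[of p] by auto
  next
    case p: False
    show ?thesis
    proof (cases "q = length us")
      case True
      with pq p show ?thesis
        using int_pow_b_int_pow_A[OF in_A, of p x y] b_iff[of q] by auto
    next
      case False
      with p pq show ?thesis
        using A_comm[OF A_int_pow A_int_pow, OF in_A in_A, of q p x y] by simp
    qed
  qed
  with pq show ?thesis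
    unfolding exchange_law_def by (simp only: nth_map mod_in_exp_range int_pow_mod_ord closed)
qed

end

section \<open>The ordered generating system\<close>

theorem proposition2p2:
  fixes G :: "('g, 'm) monoid_scheme" and A :: "'g set" and b :: 'g
    and a :: "nat \<Rightarrow> 'g" and n w :: nat and \<pi> :: "nat \<Rightarrow> nat"
    and gs :: "'g list" and rs :: "nat list"
  assumes "is_Dih G A b"
    and "finitely_generated (G\<lparr>carrier := A\<rparr>)"
    and "is_basis (G\<lparr>carrier := A\<rparr>) (map a [1..<n+1])"
    and "1 \<le> w" and "w \<le> n"
    and "\<pi> permutes {1..n}"
    and "gs = map (\<lambda>k. a (\<pi> k)) [1..<w+1] @ [b] @ map (\<lambda>k. a (\<pi> k)) [w+1..<n+1]"
    and "rs = map (\<lambda>k. group.ord G (a (\<pi> k))) [1..<w+1] @ [2] @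
              map (\<lambda>k. group.ord G (a (\<pi> k))) [w+1..<n+1]"
  shows "is_OGS G gs rs
    \<and> (\<forall>j\<in>{1..n}. \<forall>k\<in>{1..n}.
         a (\<pi> k) \<otimes>\<^bsub>G\<^esub> a (\<pi> j) = a (\<pi> j) \<otimes>\<^bsub>G\<^esub> a (\<pi> k))
    \<and> (\<forall>k\<in>{1..w}. \<forall>i::int.
         b \<otimes>\<^bsub>G\<^esub> a (\<pi> k) [^]\<^bsub>G\<^esub> i = a (\<pi> k) [^]\<^bsub>G\<^esub> (- i) \<otimes>\<^bsub>G\<^esub> b)
    \<and> (\<forall>k\<in>{w+1..n}. \<forall>i::int.
         a (\<pi> k) [^]\<^bsub>G\<^esub> i \<otimes>\<^bsub>G\<^esub> b = b \<otimes>\<^bsub>G\<^esub> a (\<pi> k) [^]\<^bsub>G\<^esub> (- i))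
    \<and> (\<forall>p q. \<forall>x y :: int. p < q \<and> q < length gs \<longrightarrow>
         exchange_law G gs rs q p x y
           ((if q = w \<and> odd x then - y else y) mod int (rs ! p))
           ((if p = w \<and> odd y then - x else x) mod int (rs ! q)))"
proof -
  interpret dihedral G A b
    using assms(1) by (intro dihedral.intro dihedral_axioms.intro) (simp add: is_Dih_def)
  let ?ks = "map \<pi> [1..<n+1]"
  define us where "us = map (\<lambda>k. a (\<pi> k)) [1..<w+1]"
  define vs where "vs = map (\<lambda>k. a (\<pi> k)) [w+1..<n+1]"
  have gs: "gs = us @ [b] @ vs" and len_us: "length us = w"
    using assms(7) by (simp_all add: us_def vs_def)
  have rs: "rs = map ord (us @ [b] @ vs)"
    using assms(8) by (simp add: us_def vs_def ord_b comp_def)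
  have "[1..<n+1] = [1..<w+1] @ [w+1..<n+1]"
    using upt_add_eq_append[of 1 "w+1" "n-w"] \<open>w \<le> n\<close> by simp
  then have uv: "us @ vs = map a ?ks"
    by (simp add: us_def vs_def)
  have \<pi>: "\<pi> permutes {1..n}" by fact
  have upt: "{1..<n+1} = {1..n}" by auto
  have ks: "distinct ?ks" "set ?ks = set [1..<n+1]"
    using permutes_inj_on[OF \<pi>] permutes_image[OF \<pi>]
    by (simp_all only: distinct_map set_map set_upt upt distinct_upt)
  have aA: "a ` set [1..<n+1] \<subseteq> A"
    using assms(3) by (simp add: is_basis_def)
  have uvA: "set us \<subseteq> A" "set vs \<subseteq> A"
  proof -
    have "set us \<union> set vs = a ` set ?ks"
      using arg_cong[OF uv, of set] by (simp only: set_append set_map)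
    then show "set us \<subseteq> A" "set vs \<subseteq> A"
      using aA unfolding ks(2) by blast+
  qed
  have a\<pi>A: "a (\<pi> k) \<in> A" if "k \<in> {1..n}" for k
    using aA that permutes_in_image[OF \<pi>, of k] by (auto simp: image_subset_iff simp del: upt_Suc)
  have "unique_presentation (G\<lparr>carrier := A\<rparr>) (us @ vs) (map ord us @ map ord vs) c" if "c \<in> A" for c
  proof -
    have "unique_presentation (G\<lparr>carrier := A\<rparr>) (map a [1..<n+1]) (map (ord \<circ> a) [1..<n+1]) c"
      using assms(3) that by (simp add: is_basis_def ord_subgroup[OF subgroup_A] comp_def)
    then show ?thesis
      using A.unique_presentation_reorder[OF ks(1) distinct_upt ks(2), of a "ord \<circ> a" c] aA ks(2)
      unfolding map_append[symmetric] uv by (simp add: comp_assoc del: upt_Suc)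
  qed
  then have "\<forall>x\<in>carrier G. unique_presentation G gs rs x"
    using unique_presentation_insert_b[OF uvA] by (simp add: gs rs ord_b)
  moreover have "set gs \<subseteq> carrier G"
    using uvA by (auto simp: gs)
  moreover have "list_all2 (\<lambda>g r. if ord g = 0 then r = 0 else r dvd ord g) gs rs"
    by (simp add: gs rs list_all2_conv_all_nth del: map_append)
  ultimately have "is_OGS G gs rs"
    by (simp add: is_OGS_def)
  moreover have "exchange_law G gs rs q p x y
      ((if q = w \<and> odd x then - y else y) mod int (rs ! p))
      ((if p = w \<and> odd y then - x else x) mod int (rs ! q))"
    if "p < q" "q < length gs" for p q x y
    using exchange_law_insert_b[OF uvA that(1), of x y] that by (simp only: gs rs len_us)
  moreover have "a (\<pi> k) \<otimes>\<^bsub>G\<^esub> a (\<pi> j) = a (\<pi> j) \<otimes>\<^bsub>G\<^esub> a (\<pi> k)" if "j \<in> {1..n}" "k \<in> {1..n}" for j k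
    using that by (intro A_comm a\<pi>A)
  moreover have "b \<otimes>\<^bsub>G\<^esub> a (\<pi> k) [^]\<^bsub>G\<^esub> i = a (\<pi> k) [^]\<^bsub>G\<^esub> (- i) \<otimes>\<^bsub>G\<^esub> b" if "k \<in> {1..w}" for k and i :: int
    using that \<open>w \<le> n\<close> by (intro b_int_pow_A a\<pi>A) auto
  moreover have "a (\<pi> k) [^]\<^bsub>G\<^esub> i \<otimes>\<^bsub>G\<^esub> b = b \<otimes>\<^bsub>G\<^esub> a (\<pi> k) [^]\<^bsub>G\<^esub> (- i)" if "k \<in> {w+1..n}" for k and i :: int
    using that b_int_pow_A[OF a\<pi>A, of k "- i"] by auto
  ultimately show ?thesis by blast
qed

end
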